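(* Let $n\ge1$ and $k\in\{0,1,\dots,2^n\}$. Then $c_{n,0}=2$, and if $k\ge1$, $$c_{n,2k}=\sum_{j=1}^{k}a_{j,k}\,2^{2jn},$$ where the rational numbers $a_{j,k}$ ($1\le j\le k$), which do not depend on $n$, are defined recursively as in the context.
   Context: The polynomials $p_n(x)\in\mathbb{Z}[x]$ are defined by $p_0(x)=x^2-2$ and $p_n(x)=p_{n-1}(x)^2-2$ for $n\ge1$; $c_{n,k}$ denotes the coefficient of $x^k$ in $p_n(x)$. Let $\epsilon(k)=1$ if $k$ is even and $0$ if $k$ is odd. For $k\ge1$ let $\eta_k=\lceil\log_2 k\rceil$, and for $j\ge2$ let $b_j=2^{-2}(2^{2(j-1)}-1)^{-1}$. Empty sums are $0$. The numbers $a_{j,k}$ ($1\le j\le k$) are defined by recursion on $k$, and for fixed $k\ge2$ first for $j=k,k-1,\dots,2$ and then for $j=1$: $a_{1,1}=-1$; for $k\ge2$ and $j\in\{2,\dots,k\}$: $a_{j,k}=b_j\,w_0(j,k)$; for $k\ge2$: $a_{1,k}=\sum_{l=2}^{k}\big(2^{-2l}w_k(l,k)-a_{l,k}\big)\,2^{2\eta_k(l-1)}$. Here, for $L\in\{0,k\}$, $w_L(j,k)=\epsilon(k)\epsilon(j)\,a_{j/2,k/2}^2+u(j,k)+2v_L(j,k)$ (the first term being $0$ unless $j$ and $k$ are both even), where $u(j,k)=2\sum_{l=\max(1,\,j-k/2)}^{\min(\lfloor (j-1)/2\rfloor,\,k/2-1)}a_{l,k/2}\,a_{j-l,k/2}$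 if $k$ is even and $3\le j\le k-1$, and $u(j,k)=0$ otherwise; $v_L(j,k)=\sum_{s=\sigma_L}^{\lfloor (k-1)/2\rfloor}\ \sum_{r=\max(1,\,j-k+s)}^{\min(j-1,\,s)}a_{r,s}\,a_{j-r,k-s}$, with $\sigma_0=0$ and $\sigma_k=k-2^{\eta_k-1}$. *)

theory Defs
  imports Complex_Main "HOL-Computational_Algebra.Polynomial"
begin

fun p_poly :: "nat \<Rightarrow> int poly" where
  "p_poly 0 = [:-2, 0, 1:]"
| "p_poly (Suc n) = (p_poly n)\<^sup>2 - 2"

definition c_coeff :: "nat \<Rightarrow> nat \<Rightarrow> int" where
  "c_coeff n k = coeff (p_poly n) k"

definition eta :: "nat \<Rightarrow> nat" where
  "eta k = nat \<lceil>log 2 (real k)\<rceil>"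

definition b_num :: "nat \<Rightarrow> rat" where
  "b_num j = 1 / (2 ^ 2 * (2 ^ (2 * (j - 1)) - 1))"

text \<open>The lower summation bound of \<open>v_num L j k\<close>; it is only used for \<open>L \<in> {0, k}\<close>.\<close>

definition sigma :: "nat \<Rightarrow> nat \<Rightarrow> nat" where
  "sigma L k = (if L = 0 then 0 else k - 2 ^ (eta k - 1))"

text \<open>
  The numbers \<open>a_num j k\<close> are meaningful for \<open>1 \<le> j \<le> k\<close> only and are set to \<open>0\<close> elsewhere; the
  recursion never refers to one of these dummy values when \<open>w_num\<close>, \<open>u_num\<close>, \<open>v_num\<close> are called with
  \<open>2 \<le> j \<le> k\<close>.  Lower summation bounds of the form \<open>max(1, x - y)\<close> are not affected by the
  truncation of subtraction on \<^typ>\<open>nat\<close>; the bound \<open>j - k + s\<close> is written \<open>j + s - k\<close> for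
  this reason.
\<close>

function a_num :: "nat \<Rightarrow> nat \<Rightarrow> rat"
  and w_num :: "nat \<Rightarrow> nat \<Rightarrow> nat \<Rightarrow> rat"
  and u_num :: "nat \<Rightarrow> nat \<Rightarrow> rat"
  and v_num :: "nat \<Rightarrow> nat \<Rightarrow> nat \<Rightarrow> rat"
where
  "a_num j k =
    (if \<not> (1 \<le> j \<and> j \<le> k) then 0
     else if k = 1 then - 1
     else if 2 \<le> j then b_num j * w_num 0 j k
     else (\<Sum>l = 2..k. (w_num k l k / 2 ^ (2 * l) - a_num l k) * 2 ^ (2 * eta k * (l - 1))))"
| "w_num L j k = (if even k \<and> even j then (a_num (j div 2) (k div 2))\<^sup>2 else 0) + u_num j k + 2 * v_num L j k"
| "u_num j k =
    (if even k \<and> 3 \<le> j \<and> j \<le> k - 1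
     then 2 * (\<Sum>l = max 1 (j - k div 2)..min ((j - 1) div 2) (k div 2 - 1).
                 a_num l (k div 2) * a_num (j - l) (k div 2))
     else 0)"
| "v_num L j k =
    (\<Sum>s = sigma L k..(k - 1) div 2.
       \<Sum>r = max 1 (j + s - k)..min (j - 1) s. a_num r s * a_num (j - r) (k - s))"
  by pat_completeness auto
termination
  by (relation "inv_image (less_than <*lex*> less_than)
        (\<lambda>x. case x of
           Inl (Inl (j, k)) \<Rightarrow> (k, if \<not> (1 \<le> j \<and> j \<le> k) then 0 else if 2 \<le> j then 3 else 4)
         | Inl (Inr (L, j, k)) \<Rightarrow> (k, 2)
         | Inr (Inl (j, k)) \<Rightarrow> (k, 1)
         | Inr (Inr (L, j, k)) \<Rightarrow> (k, 1 :: nat))")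
     auto

declare a_num.simps [simp del] w_num.simps [simp del] u_num.simps [simp del] v_num.simps [simp del]

end

theory Submission
  imports Defs
begin

text \<open>
  Writing \<open>C\<^sub>n(k)\<close> for the coefficient of \<open>x\<^bsup>2k\<^esup>\<close>, squaring gives
  \<open>C\<^sub>n\<^sub>+\<^sub>1(k) = \<Sum>\<^sub>s C\<^sub>n(s) C\<^sub>n(k - s)\<close>, and \<open>C\<^sub>n(0) = 2\<close> turns this into
  \<open>C\<^sub>n\<^sub>+\<^sub>1(k) = 4 C\<^sub>n(k) + \<Sum>\<^sub>0\<^sub><\<^sub>s\<^sub><\<^sub>k C\<^sub>n(s) C\<^sub>n(k - s)\<close>.
  With \<open>A\<^sub>k(t) = \<Sum>\<^sub>j a\<^sub>j\<^sub>,\<^sub>k t\<^sup>j\<close>, the number \<open>w\<^sub>L(j,k)\<close> is the coefficient of \<open>t\<^sup>j\<close> in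
  \<open>\<Sum>\<^sub>s A\<^sub>s A\<^sub>k\<^sub>-\<^sub>s\<close>, where \<open>s\<close> ranges from \<open>\<sigma>\<^sub>L\<close> to \<open>k - \<sigma>\<^sub>L\<close>: the terms \<open>s\<close> and \<open>k - s\<close> are
  paired. The definition of \<open>a\<^sub>j\<^sub>,\<^sub>k\<close> for \<open>j \<ge> 2\<close> says exactly that \<open>A\<^sub>k(4\<^sup>n)\<close> satisfies the recurrence
  in \<open>n\<close>; the definition of \<open>a\<^sub>1\<^sub>,\<^sub>k\<close> says that the two sides agree at \<open>n = \<eta>\<^sub>k\<close>, the least \<open>n\<close> with
  \<open>k \<le> 2\<^sup>n\<close>, where \<open>C\<^sub>n\<^sub>-\<^sub>1(s)\<close> vanishes for \<open>s > 2\<^bsup>n-1\<^esup>\<close>.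
\<close>

text \<open>The reflection s -> k - s exchanges both halves of the range and fixes only k/2. It
  serves twice: for the products A_s A_{k-s}, and inside the square of A_{k/2}.\<close>

lemma sum_symmetric_pairs:
  fixes g :: "nat \<Rightarrow> 'a :: comm_semiring_1"
  assumes sym: "\<And>s. s \<le> k \<Longrightarrow> g (k - s) = g s" and "2 * m \<le> k" and "0 < k"
  shows "(\<Sum>s = m..k - m. g s) = (if even k then g (k div 2) else 0) + 2 * (\<Sum>s = m..(k - 1) div 2. g s)"
proof -
  let ?lo = "{m..(k - 1) div 2}" and ?mid = "if even k then {k div 2} else {}"
    and ?hi = "{k - (k - 1) div 2..k - m}"
  have "{m..k - m} = ?mid \<union> (?lo \<union> ?hi)"
    using assms(2,3) by (auto elim!: evenE oddE)
  moreover have "?mid \<inter> (?lo \<union> ?hi) = {}" "?lo \<inter> ?hi = {}"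
    using assms(2,3) by (auto elim!: evenE oddE)
  ultimately have "(\<Sum>s = m..k - m. g s) = sum g ?mid + (sum g ?lo + sum g ?hi)"
    by (simp add: sum.union_disjoint)
  also have "sum g ?hi = sum g ?lo"
    by (rule sum.reindex_bij_witness[of _ "\<lambda>s. k - s" "\<lambda>s. k - s"])
       (use assms in auto)
  finally show ?thesis
    by (simp add: mult_2)
qed

section \<open>The polynomials A_k and \<open>w_num\<close> as a coefficient\<close>

definition a_poly :: "nat \<Rightarrow> rat poly" where
  "a_poly k = (\<Sum>j = 1..k. monom (a_num j k) j)"

lemma a_num_eq_0: "j = 0 \<or> k < j \<Longrightarrow> a_num j k = 0"
  by (subst a_num.simps) auto

lemma a_num_1_1 [simp]: "a_num 1 1 = -1" "a_num (Suc 0) (Suc 0) = -1"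
  by (subst a_num.simps, simp)+

lemma coeff_a_poly [simp]: "coeff (a_poly k) j = a_num j k"
proof -
  have "coeff (a_poly k) j = (\<Sum>i = 1..k. if i = j then a_num i k else 0)"
    by (simp add: a_poly_def coeff_sum)
  then show ?thesis
    by (auto simp: a_num_eq_0)
qed

lemma poly_a_poly: "poly (a_poly k) x = (\<Sum>j = 1..k. a_num j k * x ^ j)"
  by (simp add: a_poly_def poly_sum poly_monom)

lemma degree_a_poly: "degree (a_poly k) \<le> k"
  by (rule degree_le) (simp add: a_num_eq_0)

lemma a_poly_0 [simp]: "a_poly 0 = 0"
  by (simp add: a_poly_def)

definition w_poly :: "nat \<Rightarrow> nat \<Rightarrow> rat poly" where
  "w_poly m k = (\<Sum>s = m..k - m. a_poly s * a_poly (k - s))"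

lemma degree_w_poly: "degree (w_poly m k) \<le> k"
  unfolding w_poly_def
proof (intro degree_sum_le)
  fix s assume "s \<in> {m..k - m}"
  then show "degree (a_poly s * a_poly (k - s)) \<le> k"
    using degree_mult_le[of "a_poly s" "a_poly (k - s)"] degree_a_poly[of s] degree_a_poly[of "k - s"]
    by auto
qed auto

text \<open>The bounds only discard indices at which one factor is the default value 0 of
  \<open>a_num\<close>.\<close>

lemma coeff_a_poly_mult:
  "coeff (a_poly s * a_poly (k - s)) j =
     (\<Sum>r = max 1 (j + s - k)..min (j - 1) s. a_num r s * a_num (j - r) (k - s))"
proof -
  have "coeff (a_poly s * a_poly (k - s)) j = (\<Sum>r\<le>j. a_num r s * a_num (j - r) (k - s))"
    by (simp add: coeff_mult)
  also have "\<dots> = (\<Sum>r = max 1 (j + s - k)..min (j - 1) s. a_num r s * a_num (j - r) (k - s))"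
  proof (rule sum.mono_neutral_right)
    show "\<forall>r\<in>{..j} - {max 1 (j + s - k)..min (j - 1) s}. a_num r s * a_num (j - r) (k - s) = 0"
    proof
      fix r assume "r \<in> {..j} - {max 1 (j + s - k)..min (j - 1) s}"
      then have "r = 0 \<or> s < r \<or> j - r = 0 \<or> k - s < j - r"
        by auto
      then show "a_num r s * a_num (j - r) (k - s) = 0"
        by (auto simp: a_num_eq_0)
    qed
  qed auto
  finally show ?thesis .
qed

text \<open>The guard and the tight bounds drop only zero terms: for j <= 2 just l = 0 is left, and
  for j >= k always j - l > k/2.\<close>

lemma u_num_eq:
  assumes "even k" "0 < k"
  shows "u_num j k = 2 * (\<Sum>l = 0..(j - 1) div 2. a_num l (k div 2) * a_num (j - l) (k div 2))"
proof -
  define m where "m = k div 2"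
  have k: "k = 2 * m" "0 < m"
    using assms by (auto simp: m_def)
  let ?f = "\<lambda>l. a_num l m * a_num (j - l) m"
  have vanish: "?f l = 0" if "l = 0 \<or> m < l \<or> m < j - l \<or> j \<le> l" for l
    using that by (auto simp: a_num_eq_0)
  show ?thesis
  proof (cases "3 \<le> j \<and> j \<le> k - 1")
    case True
    have "(\<Sum>l = 0..(j - 1) div 2. ?f l) = (\<Sum>l = max 1 (j - m)..min ((j - 1) div 2) (m - 1). ?f l)"
    proof (rule sum.mono_neutral_right)
      show "\<forall>l\<in>{0..(j - 1) div 2} - {max 1 (j - m)..min ((j - 1) div 2) (m - 1)}. ?f l = 0"
        by (intro ballI vanish) (auto simp: k)
    qed auto
    with True assms show ?thesis
      by (simp add: u_num.simps[of j k] m_def[symmetric])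
  next
    case False
    have "(\<Sum>l = 0..(j - 1) div 2. ?f l) = 0"
      by (intro sum.neutral ballI vanish) (use False k in auto)
    with False show ?thesis
      unfolding u_num.simps[of j k] m_def[symmetric] by auto
  qed
qed

text \<open>This is the middle term s = k/2 of the convolution. Pairing l with j - l leaves the
  diagonal term and twice the lower half, which is \<open>u_num\<close>.\<close>

lemma coeff_a_poly_square:
  assumes "even k" "0 < k"
  shows "coeff (a_poly (k div 2) * a_poly (k div 2)) j =
    (if even j then (a_num (j div 2) (k div 2))\<^sup>2 else 0) + u_num j k"
proof (cases "j = 0")
  case True
  then show ?thesis
    by (simp add: coeff_mult a_num_eq_0 u_num.simps)
next
  case False
  have "coeff (a_poly (k div 2) * a_poly (k div 2)) j =
      (\<Sum>l = 0..j - 0. a_num l (k div 2) * a_num (j - l) (k div 2))"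
    by (simp add: coeff_mult atLeast0AtMost)
  also have "\<dots> = (if even j then a_num (j div 2) (k div 2) * a_num (j - j div 2) (k div 2) else 0) +
      2 * (\<Sum>l = 0..(j - 1) div 2. a_num l (k div 2) * a_num (j - l) (k div 2))"
    by (rule sum_symmetric_pairs) (use False in auto)
  finally show ?thesis
    using assms by (auto simp: u_num_eq power2_eq_square elim!: evenE)
qed

lemma w_num_eq_coeff:
  assumes "2 * sigma L k \<le> k" "0 < k"
  shows "w_num L j k = coeff (w_poly (sigma L k) k) j"
proof -
  let ?g = "\<lambda>s. coeff (a_poly s * a_poly (k - s)) j"
  have "coeff (w_poly (sigma L k) k) j = (\<Sum>s = sigma L k..k - sigma L k. ?g s)"
    by (simp add: w_poly_def coeff_sum)
  also have "\<dots> = (if even k then ?g (k div 2) else 0) + 2 * (\<Sum>s = sigma L k..(k - 1) div 2. ?g s)"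
    by (rule sum_symmetric_pairs) (use assms in \<open>auto simp: mult.commute\<close>)
  also have "(\<Sum>s = sigma L k..(k - 1) div 2. ?g s) = v_num L j k"
    by (simp add: v_num.simps[of L] coeff_a_poly_mult)
  also have "(if even k then ?g (k div 2) else 0) =
      (if even k \<and> even j then (a_num (j div 2) (k div 2))\<^sup>2 else 0) + u_num j k"
  proof (cases "even k")
    case True
    then have "k - k div 2 = k div 2"
      by auto
    with True assms(2) show ?thesis
      using coeff_a_poly_square[of k j] by simp
  qed (simp add: u_num.simps)
  finally show ?thesis
    by (simp add: w_num.simps[of L])
qed

lemma coeff_w_poly_eq_0: "j < 2 \<Longrightarrow> coeff (w_poly m k) j = 0"
  by (auto simp: w_poly_def coeff_sum coeff_mult a_num_eq_0 less_2_cases_iff)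

section \<open>The functional equation relating A_k(4t) to A_k(t)\<close>

lemma poly_eq_sum_coeff:
  fixes p :: "'a :: comm_semiring_1 poly"
  assumes "degree p \<le> n"
  shows "poly p x = (\<Sum>i\<le>n. coeff p i * x ^ i)"
  unfolding poly_altdef
  by (rule sum.mono_neutral_left) (use assms in \<open>auto simp: coeff_eq_0\<close>)

text \<open>Compare coefficients of t^j. For j >= 2 this holds because \<open>b_num j\<close> is
  1/(4^j - 4). For j = 1 both sides are 4 a_{1,k}, since \<open>w_poly\<close> starts at t^2; so the
  equation leaves a_{1,k} free.\<close>

lemma a_poly_functional_equation:
  assumes "2 \<le> k"
  shows "poly (a_poly k) (4 * t) = 4 * poly (a_poly k) t + poly (w_poly 0 k) t"
proof -
  have coeffs: "a_num j k * 4 ^ j = 4 * a_num j k + coeff (w_poly 0 k) j" if "j \<le> k" for j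
  proof -
    consider "j = 0" | "j = 1" | "2 \<le> j"
      by linarith
    then show ?thesis
    proof cases
      case 3
      then obtain i where i: "j = Suc (Suc i)"
        by (metis add_2_eq_Suc le_Suc_ex)
      have "a_num j k = b_num j * w_num 0 j k"
        using 3 that by (subst a_num.simps) simp
      also have "w_num 0 j k = coeff (w_poly 0 k) j"
        using assms w_num_eq_coeff[of 0 k j] by (simp add: sigma_def)
      finally have a: "a_num j k = b_num j * coeff (w_poly 0 k) j" .
      have "(2::rat) ^ (2 * (j - 1)) = 4 ^ Suc i"
        by (simp add: power_mult i)
      then have b: "b_num j = 1 / (4 ^ j - 4)"
        by (simp add: b_num_def i algebra_simps)
      have "(1::rat) < 4 ^ Suc i"
        by (rule one_less_power) auto
      then have "(4::rat) ^ j - 4 \<noteq> 0"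
        by (simp add: i)
      then show ?thesis
        unfolding a b by (simp add: field_simps)
    qed (auto simp: coeff_w_poly_eq_0 a_num_eq_0)
  qed
  have "poly (a_poly k) (4 * t) = (\<Sum>j\<le>k. (a_num j k * 4 ^ j) * t ^ j)"
    by (simp add: poly_eq_sum_coeff[OF degree_a_poly] power_mult_distrib mult_ac)
  also have "\<dots> = (\<Sum>j\<le>k. (4 * a_num j k + coeff (w_poly 0 k) j) * t ^ j)"
    by (intro sum.cong) (auto simp: coeffs)
  also have "\<dots> = 4 * poly (a_poly k) t + poly (w_poly 0 k) t"
    by (simp add: poly_eq_sum_coeff[OF degree_a_poly] poly_eq_sum_coeff[OF degree_w_poly]
        sum.distrib sum_distrib_left algebra_simps)
  finally show ?thesis .
qed

section \<open>The exponent \<open>eta k\<close> and the value of A_k at 4^(eta k)\<close>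

lemma eta_bounds:
  assumes "2 \<le> k"
  shows "1 \<le> eta k" "k \<le> 2 ^ eta k" "2 ^ (eta k - 1) < k"
proof -
  have "0 < log 2 (real k)"
    using assms by simp
  then have pos: "0 < \<lceil>log 2 (real k)\<rceil>"
    by simp
  then show ge1: "1 \<le> eta k"
    unfolding eta_def by linarith
  have e: "real (eta k) = real_of_int \<lceil>log 2 (real k)\<rceil>"
    using pos by (simp add: eta_def)
  have "log 2 (real k) \<le> real (eta k)"
    unfolding e by (rule le_of_int_ceiling)
  then have "real k \<le> 2 powr real (eta k)"
    using assms by (simp add: log_le_iff)
  also have "\<dots> = real (2 ^ eta k)"
    by (simp add: powr_realpow)
  finally show "k \<le> 2 ^ eta k"
    by linarith
  have "real (eta k - 1) < log 2 (real k)"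
    using ge1 e ceiling_correct[of "log 2 (real k)"] by (simp add: of_nat_diff)
  then have "2 powr real (eta k - 1) < real k"
    using assms by (simp add: less_log_iff)
  also have "2 powr real (eta k - 1) = real (2 ^ (eta k - 1))"
    by (simp add: powr_realpow)
  finally show "2 ^ (eta k - 1) < k"
    by linarith
qed

lemma eta_le:
  assumes "2 \<le> k" "k \<le> 2 ^ n"
  shows "eta k \<le> n"
proof -
  have "(2::nat) ^ (eta k - 1) < 2 ^ n"
    using eta_bounds(3)[OF assms(1)] assms(2) by linarith
  then have "eta k - 1 < n"
    by simp
  then show ?thesis
    by linarith
qed

text \<open>Multiplying the definition of a_{1,k} by 4^eta turns its powers of 2 into (4^eta)^l; the
  factor 2^(-2l) lowers this to (4^(eta-1))^l in front of w. Moving the a_{l,k} to the left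
  completes A_k(4^eta).\<close>

lemma a_poly_at_eta:
  assumes "2 \<le> k"
  shows "poly (a_poly k) (4 ^ eta k) = poly (w_poly (k - 2 ^ (eta k - 1)) k) (4 ^ (eta k - 1))"
proof -
  obtain e where e: "eta k = Suc e"
    using eta_bounds(1)[OF assms] by (metis One_nat_def Suc_le_D)
  let ?\<sigma> = "k - 2 ^ e"
  have sigma: "sigma k k = ?\<sigma>"
    using assms by (simp add: sigma_def e)
  have "2 * ?\<sigma> \<le> k"
    using eta_bounds(2)[OF assms] e by simp
  then have w: "w_num k l k = coeff (w_poly ?\<sigma> k) l" for l
    using assms w_num_eq_coeff[of k k l] by (simp add: sigma)
  have split: "(\<Sum>i\<le>k. f i) = f 0 + f 1 + (\<Sum>i = 2..k. f i)" for f :: "nat \<Rightarrow> rat"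
  proof -
    have "{..k} = {0, 1} \<union> {2..k}"
      using assms by auto
    then show ?thesis
      by (simp add: sum.union_disjoint)
  qed
  have scale: "(4::rat) ^ Suc e * (x * 2 ^ (2 * Suc e * (l - 1))) = x * 4 ^ (Suc e * l)"
    if l: "2 \<le> l" for x :: rat and l
  proof -
    obtain i where i: "l = Suc i"
      using l by (cases l) auto
    have "(2::rat) ^ (2 * Suc e * (l - 1)) = 4 ^ (Suc e * i)"
      using power_mult[of "2::rat" 2 "Suc e * i"] by (simp only: i diff_Suc_1 mult.assoc) simp
    then show ?thesis
      by (simp add: i power_add algebra_simps)
  qed
  have "a_num 1 k = (\<Sum>l = 2..k. (w_num k l k / 2 ^ (2 * l) - a_num l k) * 2 ^ (2 * eta k * (l - 1)))"
    using assms by (subst a_num.simps) simp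
  then have "4 ^ Suc e * a_num 1 k = (\<Sum>l = 2..k. (w_num k l k / 2 ^ (2 * l) - a_num l k) * 4 ^ (Suc e * l))"
    unfolding e by (auto simp only: sum_distrib_left scale atLeastAtMost_iff intro!: sum.cong)
  also have "\<dots> = (\<Sum>l = 2..k. coeff (w_poly ?\<sigma> k) l * (4 ^ e) ^ l) - (\<Sum>l = 2..k. a_num l k * (4 ^ Suc e) ^ l)"
    unfolding sum_subtractf[symmetric]
  proof (rule sum.cong)
    fix l
    have "(2::rat) ^ (2 * l) = 4 ^ l" "(4::rat) ^ (Suc e * l) = 4 ^ l * (4 ^ e) ^ l"
      by (simp_all add: power_mult power_add)
    then show "(w_num k l k / 2 ^ (2 * l) - a_num l k) * 4 ^ (Suc e * l) =
        coeff (w_poly ?\<sigma> k) l * (4 ^ e) ^ l - a_num l k * (4 ^ Suc e) ^ l"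
      by (simp add: w power_mult_distrib field_simps)
  qed simp
  finally show ?thesis
    by (simp add: poly_eq_sum_coeff[OF degree_a_poly] poly_eq_sum_coeff[OF degree_w_poly]
        split e coeff_w_poly_eq_0 a_num_eq_0 algebra_simps)
qed

section \<open>The polynomials p_n in the variable x^2\<close>

fun q_poly :: "nat \<Rightarrow> int poly" where
  "q_poly 0 = [:-2, 1:]"
| "q_poly (Suc n) = (q_poly n)\<^sup>2 - 2"

text \<open>In the variable x^2, C_n(k) is an ordinary coefficient, and squaring is a Cauchy product
  without parity conditions.\<close>

lemma p_poly_eq_pcompose: "p_poly n = pcompose (q_poly n) (monom 1 2)"
proof (induction n)
  case 0
  show ?case
    by (simp add: pcompose_pCons monom_altdef numeral_2_eq_2)
next
  case (Suc n)
  have "pcompose (2 :: int poly) r = 2" for r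
    by (metis pcompose_const numeral_poly)
  with Suc show ?case
    by (simp add: pcompose_diff power2_eq_square pcompose_mult)
qed

lemma coeff_pcompose_square:
  fixes p :: "'a :: comm_ring_1 poly"
  shows "coeff (pcompose p (monom 1 2)) (2 * k) = coeff p k"
proof (induction p arbitrary: k)
  case (pCons a p)
  show ?case
    by (cases k) (simp_all add: pcompose_pCons coeff_monom_mult pCons.IH)
qed simp

lemma c_coeff_eq: "c_coeff n (2 * k) = coeff (q_poly n) k"
  by (simp add: c_coeff_def p_poly_eq_pcompose coeff_pcompose_square)

lemma coeff_q_poly_Suc:
  assumes "1 \<le> k"
  shows "coeff (q_poly (Suc n)) k = (\<Sum>s\<le>k. coeff (q_poly n) s * coeff (q_poly n) (k - s))"
proof -
  have "coeff (2 :: int poly) k = 0"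
    using assms by (metis coeff_pCons_0 coeff_pCons_Suc numeral_poly not_one_le_zero old.nat.exhaust coeff_0)
  then show ?thesis
    by (simp add: power2_eq_square coeff_mult)
qed

text \<open>The value 2 appears only after one squaring, as (-2)^2 - 2; the constant term of
  \<open>q_poly 0\<close> is -2.\<close>

lemma coeff_q_poly_0: "1 \<le> n \<Longrightarrow> coeff (q_poly n) 0 = 2"
proof (induction n rule: nat_induct_at_least)
  case base
  show ?case
    by (simp add: power2_eq_square coeff_mult numeral_poly)
next
  case (Suc n)
  then show ?case
    by (simp add: power2_eq_square coeff_mult numeral_poly)
qed

lemma degree_q_poly: "degree (q_poly n) \<le> 2 ^ n"
proof (induction n)
  case (Suc n)
  have "degree ((q_poly n)\<^sup>2) \<le> 2 ^ Suc n"
    using degree_power_le[of "q_poly n" 2] Suc by simp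
  then show ?case
    by (simp add: degree_diff_le)
qed simp

lemma coeff_q_poly_recurrence:
  assumes "1 \<le> n" "1 \<le> k"
  shows "coeff (q_poly (Suc n)) k =
    4 * coeff (q_poly n) k + (\<Sum>s = 1..k - 1. coeff (q_poly n) s * coeff (q_poly n) (k - s))"
proof -
  have "{..k} = {0, k} \<union> {1..k - 1}"
    using assms(2) by auto
  then show ?thesis
    unfolding coeff_q_poly_Suc[OF assms(2)] using assms
    by (simp add: sum.union_disjoint coeff_q_poly_0)
qed

text \<open>The degree bound confines s and k - s to at most 2^(eta k - 1) < k. This excludes s = 0
  and s = k, so only coefficients of index below k occur.\<close>

lemma coeff_q_poly_at_eta:
  assumes "2 \<le> k"
  shows "coeff (q_poly (eta k)) k =
    (\<Sum>s = k - 2 ^ (eta k - 1)..k - (k - 2 ^ (eta k - 1)). coeff (q_poly (eta k - 1)) s * coeff (q_poly (eta k - 1)) (k - s))"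
proof -
  obtain e where e: "eta k = Suc e"
    using eta_bounds(1)[OF assms] by (metis One_nat_def Suc_le_D)
  have e2: "2 ^ e < k"
    using eta_bounds(3)[OF assms] e by simp
  have vanish: "coeff (q_poly e) s = 0" if "2 ^ e < s" for s
    by (rule coeff_eq_0) (use degree_q_poly[of e] that in linarith)
  have "coeff (q_poly (Suc e)) k = (\<Sum>s\<le>k. coeff (q_poly e) s * coeff (q_poly e) (k - s))"
    using assms by (intro coeff_q_poly_Suc) simp
  also have "\<dots> = (\<Sum>s = k - 2 ^ e..k - (k - 2 ^ e). coeff (q_poly e) s * coeff (q_poly e) (k - s))"
  proof (rule sum.mono_neutral_right)
    show "\<forall>s\<in>{..k} - {k - 2 ^ e..k - (k - 2 ^ e)}. coeff (q_poly e) s * coeff (q_poly e) (k - s) = 0"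
    proof
      fix s assume "s \<in> {..k} - {k - 2 ^ e..k - (k - 2 ^ e)}"
      then have "2 ^ e < s \<or> 2 ^ e < k - s"
        using e2 by auto
      then show "coeff (q_poly e) s * coeff (q_poly e) (k - s) = 0"
        by (auto simp: vanish)
    qed
  qed auto
  finally show ?thesis
    by (simp add: e)
qed

text \<open>Strong induction on k, with an inner induction on n from \<open>eta k\<close>: the
  truncated products give the start, the common recurrence gives the step.\<close>

lemma coeff_q_poly_eq_a_poly:
  assumes "1 \<le> n" "1 \<le> k" "k \<le> 2 ^ n"
  shows "rat_of_int (coeff (q_poly n) k) = poly (a_poly k) (4 ^ n)"
  using assms
proof (induction k arbitrary: n rule: less_induct)
  case (less k)
  show ?case
  proof (cases "k = 1")
    case True
    \<comment> \<open>For index 1 the convolution is empty, so each step multiplies by 4, starting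
      from q_1 = x^2 - 4x + 2.\<close>
    have "coeff (q_poly n) 1 = - (4 ^ n)"
      using less.prems(1)
    proof (induction n rule: nat_induct_at_least)
      case base
      show ?case
        by (simp add: power2_eq_square numeral_poly)
    next
      case (Suc n)
      then show ?case
        by (simp only: coeff_q_poly_recurrence) simp
    qed
    with True show ?thesis
      by (simp add: poly_a_poly)
  next
    case False
    then have k: "2 \<le> k"
      using less.prems by simp
    have "eta k \<le> n"
      using k less.prems(3) by (rule eta_le)
    then show ?thesis
    proof (induction n rule: nat_induct_at_least)
      case base
      obtain e where e: "eta k = Suc e"
        using eta_bounds(1)[OF k] by (metis One_nat_def Suc_le_D)
      let ?\<sigma> = "k - 2 ^ e"
      have e2: "2 ^ e < k" "k \<le> 2 * 2 ^ e"
        using eta_bounds[OF k] e by simp_all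
      have "rat_of_int (coeff (q_poly (eta k)) k) =
          (\<Sum>s = ?\<sigma>..k - ?\<sigma>. rat_of_int (coeff (q_poly e) s) * rat_of_int (coeff (q_poly e) (k - s)))"
        using coeff_q_poly_at_eta[OF k] by (simp add: e)
      also have "\<dots> = (\<Sum>s = ?\<sigma>..k - ?\<sigma>. poly (a_poly s) (4 ^ e) * poly (a_poly (k - s)) (4 ^ e))"
      proof (cases "e = 0")
        case True
        \<comment> \<open>Here the induction hypothesis is not available: \<open>C\<^sub>0(1) = 1\<close> but \<open>A\<^sub>1(1) = -1\<close>. Only the squares agree.\<close>
        with e2 k have "k = 2"
          by simp
        with True show ?thesis
          by (simp add: poly_a_poly)
      next
        case False
        show ?thesis
        proof (rule sum.cong)
          fix s assume "s \<in> {?\<sigma>..k - ?\<sigma>}"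
          \<comment> \<open>Positivity of s and k - s comes from 2^e < k; the upper bound 2^e is the
            choice of the range.\<close>
          then have s: "1 \<le> s" "s < k" "s \<le> 2 ^ e" "k - s \<le> 2 ^ e" "1 \<le> k - s" "k - s < k"
            using e2 by auto
          then show "rat_of_int (coeff (q_poly e) s) * rat_of_int (coeff (q_poly e) (k - s)) =
              poly (a_poly s) (4 ^ e) * poly (a_poly (k - s)) (4 ^ e)"
            using False less.IH[of s e] less.IH[of "k - s" e] by simp
        qed simp
      qed
      also have "\<dots> = poly (a_poly k) (4 ^ eta k)"
        using a_poly_at_eta[OF k] by (simp add: e w_poly_def poly_sum)
      finally show ?case .
    next
      case (Suc n)
      have n: "1 \<le> n"
        using Suc.hyps eta_bounds(1)[OF k] by linarith
      have "(2::nat) ^ eta k \<le> 2 ^ n"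
        using Suc.hyps by simp
      then have kn: "k \<le> 2 ^ n"
        using eta_bounds(2)[OF k] by linarith
      have "rat_of_int (coeff (q_poly (Suc n)) k) = 4 * rat_of_int (coeff (q_poly n) k) +
          (\<Sum>s = 1..k - 1. rat_of_int (coeff (q_poly n) s) * rat_of_int (coeff (q_poly n) (k - s)))"
        using k by (simp only: coeff_q_poly_recurrence[OF n]) simp
      also have "(\<Sum>s = 1..k - 1. rat_of_int (coeff (q_poly n) s) * rat_of_int (coeff (q_poly n) (k - s))) =
          (\<Sum>s = 1..k - 1. poly (a_poly s) (4 ^ n) * poly (a_poly (k - s)) (4 ^ n))"
      proof (rule sum.cong)
        fix s assume "s \<in> {1..k - 1}"
        then have "1 \<le> s" "s < k" "s \<le> 2 ^ n" "k - s \<le> 2 ^ n" "1 \<le> k - s" "k - s < k"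
          using kn by auto
        then show "rat_of_int (coeff (q_poly n) s) * rat_of_int (coeff (q_poly n) (k - s)) =
            poly (a_poly s) (4 ^ n) * poly (a_poly (k - s)) (4 ^ n)"
          using n less.IH[of s n] less.IH[of "k - s" n] by simp
      qed simp
      also have "\<dots> = poly (w_poly 0 k) (4 ^ n)"
        \<comment> \<open>The ends s = 0 and s = k contribute nothing since A_0 = 0, whereas C_n(0)
          = 2 produced the separate term 4 C_n(k).\<close>
        unfolding w_poly_def poly_sum poly_mult
        by (rule sum.mono_neutral_left) (auto simp: not_le)
      finally show ?case
        using Suc.IH a_poly_functional_equation[OF k, of "4 ^ n"] by simp
    qed
  qed
qed

theorem theorem2p5:
  fixes n k :: nat
  assumes "n \<ge> 1" and "k \<in> {0..2 ^ n}"
  shows "c_coeff n 0 = 2 \<and>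
    (k \<ge> 1 \<longrightarrow> rat_of_int (c_coeff n (2 * k)) = (\<Sum>j = 1..k. a_num j k * 2 ^ (2 * j * n)))"
proof (intro conjI impI)
  show "c_coeff n 0 = 2"
    using c_coeff_eq[of n 0] coeff_q_poly_0[OF assms(1)] by simp
  have "(4 ^ n) ^ j = (2::rat) ^ (2 * j * n)" for j
    using power_mult[of "2::rat" 2 "n * j"] by (simp add: power_mult[symmetric] mult_ac)
  then show "rat_of_int (c_coeff n (2 * k)) = (\<Sum>j = 1..k. a_num j k * 2 ^ (2 * j * n))" if "k \<ge> 1"
    using coeff_q_poly_eq_a_poly[OF assms(1) that] assms(2) by (simp add: c_coeff_eq poly_a_poly)
qed

end
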